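(* Let $q\in\mathbb{C}$ with $0<|q|<1$. The incomplete $q$-Chebyshev polynomials of the second kind $\mathcal{U}_n^k=\mathcal{U}_n^k(x,s,q)$ satisfy, for all integers $n,k$ with $0\le k\le \frac{n-1}{2}$, $$\mathcal{U}_{n+2}^{k+1}=(1+q^{n+2})\,x\,\mathcal{U}_{n+1}^{k+1}+q^{n+1}s\,\mathcal{U}_{n}^{k}.$$
   Context: Notation: $[n]_q=\frac{1-q^n}{1-q}$, $[0]_q=0$; $(a;q)_0=1$ and $(a;q)_n=\prod_{i=0}^{n-1}(1-q^i a)$; $\begin{bmatrix} n\\k\end{bmatrix}_q=\frac{(q;q)_n}{(q;q)_{n-k}(q;q)_k}$ for $0\le k\le n$, and it is $0$ for $n<k$. Here $x,s$ are indeterminates. For a nonnegative integer $n$ and $0\le k\le\lfloor n/2\rfloor$, the incomplete $q$-Chebyshev polynomials of the second kind are $$\mathcal{U}_n^k(x,s,q)=\sum_{j=0}^{k}q^{j^2}\begin{bmatrix} n-j\\ j\end{bmatrix}_q\frac{(-q;q)_{n-j}}{(-q;q)_j}\,s^jx^{n-2j}.$$ *)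

theory Defs
  imports Complex_Main "HOL-Computational_Algebra.Polynomial"
begin

definition qpoch :: "complex \<Rightarrow> complex \<Rightarrow> nat \<Rightarrow> complex" where
  "qpoch a q n = (\<Prod>i<n. 1 - q ^ i * a)"

definition qbinom :: "complex \<Rightarrow> nat \<Rightarrow> nat \<Rightarrow> complex" where
  "qbinom q n k = (if k \<le> n then qpoch q q n / (qpoch q q (n - k) * qpoch q q k) else 0)"

(* The ring C[x,s] is represented as (C[x])[s], i.e. as the type complex poly poly. *)

definition const2 :: "complex \<Rightarrow> complex poly poly" where
  "const2 c = [:[:c:]:]"

definition indet_x :: "complex poly poly" where
  "indet_x = [:[:0, 1:]:]"

definition indet_s :: "complex poly poly" where
  "indet_s = [:0, 1:]"

(* Meaningful for 2 * k \<le> n; otherwise the truncated subtractions on nat occur in the sum. *)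
definition incomplete_qcheb_U ::
    "nat \<Rightarrow> nat \<Rightarrow> complex poly poly \<Rightarrow> complex poly poly \<Rightarrow> complex \<Rightarrow> complex poly poly" where
  "incomplete_qcheb_U n k x s q =
     (\<Sum>j\<le>k. const2 (q ^ (j\<^sup>2) * qbinom q (n - j) j * (qpoch (- q) q (n - j) / qpoch (- q) q j))
             * s ^ j * x ^ (n - 2 * j))"

end

theory Submission
  imports Defs
begin

text \<open>
  Both sides are polynomials in \<open>s\<close> and \<open>x\<close>, and the recurrence is checked on the coefficient of
  \<open>s\<^sup>j x\<^sup>n\<^sup>+\<^sup>2\<^sup>-\<^sup>2\<^sup>j\<close> for each \<open>j \<le> k + 1\<close>.  For \<open>j = 0\<close> it is the recursion
  \<open>(-q;q)\<^sub>n\<^sub>+\<^sub>2 = (1 + q\<^sup>n\<^sup>+\<^sup>2) (-q;q)\<^sub>n\<^sub>+\<^sub>1\<close>.  For \<open>j = i + 1\<close>, put \<open>N = n - i\<close>; after cancelling the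
  common factor \<open>q\<^sup>j\<^sup>*\<^sup>j (-q;q)\<^sub>N / (-q;q)\<^sub>j\<close> the claim reads, with square brackets for
  \<open>q\<close>-binomial coefficients,
  \<open>(1 + q\<^sup>N\<^sup>+\<^sup>1) [N+1, j] = (1 + q\<^sup>N\<^sup>+\<^sup>1\<^sup>+\<^sup>j) [N, j] + q\<^sup>N\<^sup>+\<^sup>1\<^sup>-\<^sup>j (1 + q\<^sup>j) [N, j-1]\<close>.
  This is the sum of the \<open>q\<close>-Pascal rule \<open>[N+1, j] = [N, j] + q\<^sup>N\<^sup>+\<^sup>1\<^sup>-\<^sup>j [N, j-1]\<close> and of
  \<open>q\<^sup>N\<^sup>+\<^sup>1\<close> times the other one, \<open>[N+1, j] = q\<^sup>j [N, j] + [N, j-1]\<close>.  No denominator vanishes because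
  \<open>|q| < 1\<close>.
\<close>

lemma qpoch_0 [simp]: "qpoch a q 0 = 1"
  by (simp add: qpoch_def)

lemma qpoch_Suc: "qpoch a q (Suc n) = qpoch a q n * (1 - q ^ n * a)"
  by (simp add: qpoch_def)

lemma qpoch_q_Suc: "qpoch q q (Suc n) = qpoch q q n * (1 - q ^ Suc n)"
  by (simp add: qpoch_Suc mult.commute)

lemma qpoch_minus_q_Suc: "qpoch (- q) q (Suc n) = qpoch (- q) q n * (1 + q ^ Suc n)"
  by (simp add: qpoch_Suc mult.commute)

lemma qpoch_nonzero:
  assumes "norm q < 1" and "norm a < 1"
  shows "qpoch a q n \<noteq> 0"
proof -
  have "1 - q ^ i * a \<noteq> 0" for i
  proof -
    have "norm (q ^ i * a) \<le> 1 * norm a"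
      unfolding norm_mult norm_power using assms by (intro mult_right_mono power_le_one) auto
    then have "norm (q ^ i * a) < 1"
      using assms by linarith
    then show ?thesis
      by auto
  qed
  then show ?thesis
    by (simp add: qpoch_def)
qed

lemma qbinom_0 [simp]:
  assumes "norm q < 1"
  shows "qbinom q n 0 = 1"
  using qpoch_nonzero[OF assms assms] by (simp add: qbinom_def)

text \<open>
  The two \<open>q\<close>-Pascal rules.  The case \<open>i = N\<close>, where \<open>qbinom q N (Suc i)\<close> is zero by
  convention and not given by the quotient of factorials, has to be treated separately.
\<close>

lemma qbinom_Suc_Suc:
  assumes "norm q < 1" and "i \<le> N"
  shows "qbinom q (Suc N) (Suc i) = qbinom q N (Suc i) + q ^ (N - i) * qbinom q N i"
proof (cases "i = N")
  case True
  then show ?thesis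
    using qpoch_nonzero[of q q] assms by (simp add: qbinom_def)
next
  case False
  then obtain d where N: "N = Suc (i + d)"
    using assms(2) by (metis le_neq_implies_less less_natE)
  have nz: "qpoch q q m \<noteq> 0" for m
    using assms by (intro qpoch_nonzero)
  have nz': "1 - q ^ Suc m \<noteq> 0" for m
    using nz[of "Suc m"] unfolding qpoch_q_Suc by auto
  have "qbinom q (Suc N) (Suc i) =
      qpoch q q N * (1 - q ^ Suc N) / (qpoch q q d * (1 - q ^ Suc d) * (qpoch q q i * (1 - q ^ Suc i)))"
    by (simp add: qbinom_def N qpoch_q_Suc del: power_Suc)
  moreover have "qbinom q N (Suc i) =
      qpoch q q N / (qpoch q q d * (qpoch q q i * (1 - q ^ Suc i)))"
    by (simp add: qbinom_def N qpoch_q_Suc del: power_Suc)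
  moreover have "qbinom q N i = qpoch q q N / (qpoch q q d * (1 - q ^ Suc d) * qpoch q q i)"
    by (simp add: qbinom_def N Suc_diff_le qpoch_q_Suc del: power_Suc)
  moreover have "N - i = Suc d"
    by (simp add: N)
  moreover have "1 - q ^ Suc N = (1 - q ^ Suc d) + q ^ Suc d * (1 - q ^ Suc i)"
    by (simp add: N algebra_simps power_add)
  moreover have "F * (u + w * v) / (D * u * (I * v)) = F / (D * (I * v)) + w * (F / (D * u * I))"
    if "D \<noteq> 0" "I \<noteq> 0" "u \<noteq> 0" "v \<noteq> 0" for F u v w D I :: complex
    using that by (simp add: field_simps)
  ultimately show ?thesis
    using nz nz' by presburger
qed

lemma qbinom_Suc_Suc':
  assumes "norm q < 1" and "i \<le> N"
  shows "qbinom q (Suc N) (Suc i) = q ^ Suc i * qbinom q N (Suc i) + qbinom q N i"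
proof (cases "i = N")
  case True
  then show ?thesis
    using qpoch_nonzero[of q q] assms by (simp add: qbinom_def)
next
  case False
  then obtain d where N: "N = Suc (i + d)"
    using assms(2) by (metis le_neq_implies_less less_natE)
  have nz: "qpoch q q m \<noteq> 0" for m
    using assms by (intro qpoch_nonzero)
  have nz': "1 - q ^ Suc m \<noteq> 0" for m
    using nz[of "Suc m"] unfolding qpoch_q_Suc by auto
  \<comment> \<open>The difference of the two rules is this relation between neighbouring coefficients.\<close>
  have "(1 - q ^ Suc d) * qbinom q N i = (1 - q ^ Suc i) * qbinom q N (Suc i)"
    using nz[of d] nz[of i] nz'[of d] nz'[of i]
    by (simp add: qbinom_def N Suc_diff_le qpoch_q_Suc del: power_Suc)
  moreover have "N - i = Suc d"
    by (simp add: N)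
  ultimately show ?thesis
    using qbinom_Suc_Suc[OF assms] by (simp add: algebra_simps)
qed

text \<open>The coefficient of \<open>s\<^sup>j x\<^sup>n\<^sup>-\<^sup>2\<^sup>j\<close> in the \<open>n\<close>-th \<open>q\<close>-Chebyshev polynomial of the second kind,
  for \<open>2 * j \<le> n\<close>.\<close>

definition qcheb_U_coeff :: "complex \<Rightarrow> nat \<Rightarrow> nat \<Rightarrow> complex" where
  "qcheb_U_coeff q n j =
     q ^ (j\<^sup>2) * qbinom q (n - j) j * (qpoch (- q) q (n - j) / qpoch (- q) q j)"

lemma qcheb_U_coeff_0:
  assumes "norm q < 1"
  shows "qcheb_U_coeff q (Suc n) 0 = (1 + q ^ Suc n) * qcheb_U_coeff q n 0"
  using assms by (simp add: qcheb_U_coeff_def qpoch_minus_q_Suc)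

lemma qcheb_U_coeff_Suc:
  assumes "norm q < 1" and "2 * i + 1 \<le> n"
  shows "qcheb_U_coeff q (n + 2) (Suc i) =
           (1 + q ^ (n + 2)) * qcheb_U_coeff q (n + 1) (Suc i) + q ^ (n + 1) * qcheb_U_coeff q n i"
proof -
  define N where "N = n - i"
  have n: "n = N + i" and iN: "i \<le> N"
    using assms(2) by (simp_all add: N_def)
  define B where "B = qbinom q N (Suc i)"
  define C where "C = qbinom q N i"
  define P where "P = qpoch (- q) q N"
  define R where "R = qpoch (- q) q i"
  define u where "u = 1 + q ^ Suc i"
  define Q where "Q = q ^ ((Suc i)\<^sup>2)"
  have nz: "qpoch (- q) q m \<noteq> 0" for m
    using assms by (intro qpoch_nonzero) simp_all
  have R: "R \<noteq> 0" and u: "u \<noteq> 0"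
    using nz[of i] nz[of "Suc i"] by (auto simp: R_def u_def qpoch_minus_q_Suc)
  have pascal: "(1 + q ^ Suc N) * qbinom q (Suc N) (Suc i) =
      (1 + q ^ (n + 2)) * B + q ^ (N - i) * u * C"
  proof -
    have "q ^ (n + 2) = q ^ Suc N * q ^ Suc i"
      by (simp add: n power_add)
    moreover have "q ^ Suc N = q ^ (N - i) * q ^ Suc i"
      using iN by (simp flip: power_add)
    moreover have "(1 + q ^ Suc N) * qbinom q (Suc N) (Suc i) =
        (B + q ^ (N - i) * C) + q ^ Suc N * (q ^ Suc i * B + C)"
      using qbinom_Suc_Suc[OF assms(1) iN] qbinom_Suc_Suc'[OF assms(1) iN]
      unfolding B_def C_def by (metis distrib_right mult_1)
    ultimately show ?thesis
      by (simp add: u_def algebra_simps del: power_Suc)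
  qed
  have pow: "q ^ (n + 1) * q ^ (i\<^sup>2) = Q * q ^ (N - i)"
  proof -
    have "n + 1 + i\<^sup>2 = (Suc i)\<^sup>2 + (N - i)"
      using iN by (simp add: n power2_eq_square)
    then show ?thesis
      by (simp only: Q_def flip: power_add)
  qed
  have "qcheb_U_coeff q (n + 2) (Suc i) =
      Q * ((1 + q ^ Suc N) * qbinom q (Suc N) (Suc i)) * (P / (R * u))"
    by (simp add: qcheb_U_coeff_def n qpoch_minus_q_Suc P_def R_def u_def Q_def del: power_Suc)
  also have "\<dots> = (1 + q ^ (n + 2)) * (Q * B * (P / (R * u))) + Q * q ^ (N - i) * C * (P / R)"
    unfolding pascal using R u by (simp add: field_simps del: power_Suc)
  also have "Q * q ^ (N - i) * C * (P / R) = q ^ (n + 1) * qcheb_U_coeff q n i"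
    unfolding pow[symmetric] by (simp add: qcheb_U_coeff_def C_def P_def R_def N_def)
  also have "Q * B * (P / (R * u)) = qcheb_U_coeff q (n + 1) (Suc i)"
    by (simp add: qcheb_U_coeff_def n qpoch_minus_q_Suc B_def P_def R_def u_def Q_def del: power_Suc)
  finally show ?thesis .
qed

lemma incomplete_qcheb_U_altdef:
  "incomplete_qcheb_U n k x s q =
     (\<Sum>j\<le>k. const2 (qcheb_U_coeff q n j) * s ^ j * x ^ (n - 2 * j))"
  by (simp add: incomplete_qcheb_U_def qcheb_U_coeff_def)

lemma const2_add: "const2 (a + b) = const2 a + const2 b"
  by (simp add: const2_def)

lemma const2_mult: "const2 (a * b) = const2 a * const2 b"
  by (simp add: const2_def)

theorem theorem3:
  fixes q :: complex and n k :: nat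
  assumes "0 < norm q" and "norm q < 1"
    and "real k \<le> (real n - 1) / 2"
  shows "incomplete_qcheb_U (n + 2) (k + 1) indet_x indet_s q =
           const2 (1 + q ^ (n + 2)) * indet_x * incomplete_qcheb_U (n + 1) (k + 1) indet_x indet_s q
           + const2 (q ^ (n + 1)) * indet_s * incomplete_qcheb_U n k indet_x indet_s q"
proof -
  have k: "2 * k + 1 \<le> n"
  proof -
    have "real (2 * k + 1) \<le> real n"
      using assms(3) by simp
    then show ?thesis
      by (simp only: of_nat_le_iff)
  qed
  define x where "x = indet_x"
  define s where "s = indet_s"
  define c where "c = const2 (1 + q ^ (n + 2))"
  define d where "d = const2 (q ^ (n + 1))"
  define f where "f = (\<lambda>m j. const2 (qcheb_U_coeff q m j) * s ^ j * x ^ (m - 2 * j))"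
  have U: "incomplete_qcheb_U m l x s q = (\<Sum>j\<le>l. f m j)" for m l
    by (simp add: incomplete_qcheb_U_altdef f_def)
  have f_0: "f (n + 2) 0 = c * x * f (n + 1) 0"
    using qcheb_U_coeff_0[OF assms(2), of "n + 1"]
    by (simp add: f_def c_def const2_mult mult_ac)
  have f_Suc: "f (n + 2) (Suc i) = c * x * f (n + 1) (Suc i) + d * s * f n i" if "i \<le> k" for i
  proof -
    have i: "2 * i + 1 \<le> n"
      using that k by linarith
    \<comment> \<open>The bound on \<open>i\<close> keeps the exponent \<open>n + 1 - 2 * Suc i\<close> from being truncated.\<close>
    then have "n - 2 * i = Suc (n + 1 - 2 * Suc i)"
      by simp
    then have pow: "x ^ (n - 2 * i) = x * x ^ (n + 1 - 2 * Suc i)"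
      by (simp only: power_Suc)
    have "f (n + 2) (Suc i) = const2 (qcheb_U_coeff q (n + 2) (Suc i)) * s ^ Suc i * x ^ (n - 2 * i)"
      by (simp add: f_def)
    also have "\<dots> = c * const2 (qcheb_U_coeff q (n + 1) (Suc i)) * s ^ Suc i * x ^ (n - 2 * i)
        + d * const2 (qcheb_U_coeff q n i) * s ^ Suc i * x ^ (n - 2 * i)"
      unfolding qcheb_U_coeff_Suc[OF assms(2) i] const2_add[of "_ * _"] const2_mult c_def d_def
      by (simp only: distrib_right)
    also have "c * const2 (qcheb_U_coeff q (n + 1) (Suc i)) * s ^ Suc i * x ^ (n - 2 * i) =
        c * x * f (n + 1) (Suc i)"
      unfolding f_def pow by (simp only: mult_ac)
    also have "d * const2 (qcheb_U_coeff q n i) * s ^ Suc i * x ^ (n - 2 * i) = d * s * f n i"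
      unfolding f_def by (simp add: mult_ac)
    finally show ?thesis .
  qed
  have "(\<Sum>j\<le>k + 1. f (n + 2) j) = f (n + 2) 0 + (\<Sum>i\<le>k. f (n + 2) (Suc i))"
    by (simp only: Suc_eq_plus1[symmetric] sum.atMost_Suc_shift)
  also have "\<dots> = c * x * f (n + 1) 0 + (\<Sum>i\<le>k. c * x * f (n + 1) (Suc i) + d * s * f n i)"
    using f_0 f_Suc by simp
  also have "\<dots> = c * x * (f (n + 1) 0 + (\<Sum>i\<le>k. f (n + 1) (Suc i))) + d * s * (\<Sum>i\<le>k. f n i)"
    by (simp only: sum.distrib sum_distrib_left distrib_left add.assoc)
  also have "f (n + 1) 0 + (\<Sum>i\<le>k. f (n + 1) (Suc i)) = (\<Sum>j\<le>k + 1. f (n + 1) j)"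
    by (simp only: Suc_eq_plus1[symmetric] sum.atMost_Suc_shift)
  finally show ?thesis
    unfolding U[symmetric] c_def d_def x_def s_def .
qed

end
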